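(* Let $\{x_n\}$ be a bounded sequence in a partial metric space $(X,p)$, and let $M>0$ be a real number such that $\sup\{p(x_n,x_m):n,m\in\mathbb{N}\}<M$. Then $\{x_n\}$ is $r$-convergent from right of roughness degree $r=4M$ (to some point of $X$), and $\{x_n\}$ is $r$-convergent from left of roughness degree $r=2M$ (to some point of $X$).
   Context: A partial metric on a nonempty set $X$ is a function $p:X\times X\to[0,\infty)$ such that for all $x,y,z\in X$: (p1) $0\le p(x,x)\le p(x,y)$; (p2) $x=y \iff p(x,x)=p(x,y)=p(y,y)$; (p3) $p(x,y)=p(y,x)$; (p4) $p(x,y)\le p(x,z)+p(z,y)-p(z,z)$. The pair $(X,p)$ is a partial metric space. A sequence $\{x_n\}$ in $X$ is bounded if there is a real $M>0$ such that $\sup\{p(x_n,x_m):n,m\in\mathbb{N}\}<M$. For $r\ge 0$, a sequence $\{x_n\}$ is $r$-convergent to $x\in X$ from right (respectively from left) if for every $\epsilon>0$ there is $k\in\mathbb{N}$ such that, for all $n\ge k$ with $p(x_n,x)\ge p(x,x)$ (respectively with $p(x_n,x)\le p(x,x)$), one has $|p(x_n,x)-p(x,x)|<r+\epsilon$. *)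

theory Defs
  imports Complex_Main "HOL-Library.Extended_Real"
begin

text \<open>The values of \<open>p\<close> outside \<open>X\<close> are unconstrained; on \<open>X\<close> they are nonnegative by \<open>p1\<close>.\<close>

locale partial_metric_space =
  fixes X :: "'a set" and p :: "'a \<Rightarrow> 'a \<Rightarrow> real"
  assumes nonempty: "X \<noteq> {}"
    and p1: "\<lbrakk>x \<in> X; y \<in> X\<rbrakk> \<Longrightarrow> 0 \<le> p x x \<and> p x x \<le> p x y"
    and p2: "\<lbrakk>x \<in> X; y \<in> X\<rbrakk> \<Longrightarrow> x = y \<longleftrightarrow> p x x = p x y \<and> p x y = p y y"
    and p3: "\<lbrakk>x \<in> X; y \<in> X\<rbrakk> \<Longrightarrow> p x y = p y x"
    and p4: "\<lbrakk>x \<in> X; y \<in> X; z \<in> X\<rbrakk> \<Longrightarrow> p x y \<le> p x z + p z y - p z z"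

text \<open>The supremum is taken in the extended reals, so that it is \<open>\<infinity>\<close> when the set of
  values is unbounded; the real-valued \<open>Sup\<close> would be unspecified there.\<close>

definition pm_sup :: "('a \<Rightarrow> 'a \<Rightarrow> real) \<Rightarrow> (nat \<Rightarrow> 'a) \<Rightarrow> ereal" where
  "pm_sup p s = Sup {ereal (p (s n) (s m)) | n m. True}"

definition pm_bounded :: "('a \<Rightarrow> 'a \<Rightarrow> real) \<Rightarrow> (nat \<Rightarrow> 'a) \<Rightarrow> bool" where
  "pm_bounded p s \<longleftrightarrow> (\<exists>M::real. M > 0 \<and> pm_sup p s < ereal M)"

definition r_convergent_right ::
    "('a \<Rightarrow> 'a \<Rightarrow> real) \<Rightarrow> real \<Rightarrow> (nat \<Rightarrow> 'a) \<Rightarrow> 'a \<Rightarrow> bool" where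
  "r_convergent_right p r s x \<longleftrightarrow>
     (\<forall>\<epsilon>>0. \<exists>k. \<forall>n\<ge>k. p (s n) x \<ge> p x x \<longrightarrow> \<bar>p (s n) x - p x x\<bar> < r + \<epsilon>)"

definition r_convergent_left ::
    "('a \<Rightarrow> 'a \<Rightarrow> real) \<Rightarrow> real \<Rightarrow> (nat \<Rightarrow> 'a) \<Rightarrow> 'a \<Rightarrow> bool" where
  "r_convergent_left p r s x \<longleftrightarrow>
     (\<forall>\<epsilon>>0. \<exists>k. \<forall>n\<ge>k. p (s n) x \<le> p x x \<longrightarrow> \<bar>p (s n) x - p x x\<bar> < r + \<epsilon>)"

end

theory Submission
  imports Defs
begin

text \<open>The first term \<open>s 0\<close> serves as the limit from both sides. By
  \<open>p1\<close> and \<open>less_if_pm_sup_less\<close>, \<open>p (s n) (s 0)\<close> and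
  \<open>p (s 0) (s 0)\<close> both lie in [0, M), so they differ by less than \<open>M\<close>,
  hence by less than \<open>2 * M\<close> and \<open>4 * M\<close>.\<close>

lemma less_if_pm_sup_less:
  assumes "pm_sup p s < ereal M"
  shows "p (s n) (s m) < M"
proof -
  have "ereal (p (s n) (s m)) \<le> pm_sup p s"
    unfolding pm_sup_def by (rule Sup_upper) blast
  with assms have "ereal (p (s n) (s m)) < ereal M" by (rule le_less_trans[rotated])
  then show ?thesis by simp
qed

text \<open>Any term of the sequence is a rough limit from both sides: both quantities in the
  difference lie in \<open>[0, M)\<close>.\<close>

theorem theorem3p9:
  fixes X :: "'a set" and p :: "'a \<Rightarrow> 'a \<Rightarrow> real" and s :: "nat \<Rightarrow> 'a" and M :: real
  assumes "partial_metric_space X p"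
    and "range s \<subseteq> X"
    and "pm_bounded p s"
    and "M > 0"
    and "pm_sup p s < ereal M"
  shows "(\<exists>x\<in>X. r_convergent_right p (4 * M) s x) \<and>
         (\<exists>x\<in>X. r_convergent_left p (2 * M) s x)"
proof -
  interpret partial_metric_space X p by fact
  have in_X: "s n \<in> X" for n using assms(2) by blast
  have close: "\<bar>p (s n) (s 0) - p (s 0) (s 0)\<bar> < M" for n
    \<comment> \<open>The two instances of \<open>p1\<close> give 0 \<le>
      \<open>p (s 0) (s 0)\<close> and 0 \<le> \<open>p (s n) (s n)\<close> \<le>
      \<open>p (s n) (s 0)\<close>.\<close>
    using p1[OF in_X in_X, of 0 n] p1[OF in_X in_X, of n 0]
      less_if_pm_sup_less[OF assms(5), of n 0] less_if_pm_sup_less[OF assms(5), of 0 0]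
    by linarith
  have "\<bar>p (s n) (s 0) - p (s 0) (s 0)\<bar> < 4 * M + \<epsilon>"
    and "\<bar>p (s n) (s 0) - p (s 0) (s 0)\<bar> < 2 * M + \<epsilon>" if "\<epsilon> > 0" for n \<epsilon>
    using close[of n] \<open>M > 0\<close> that by linarith+
  \<comment> \<open>The bounds hold for every \<open>n\<close>, so any \<open>k\<close>
    works.\<close>
  then have "r_convergent_right p (4 * M) s (s 0)" "r_convergent_left p (2 * M) s (s 0)"
    unfolding r_convergent_right_def r_convergent_left_def by blast+
  then show ?thesis using in_X by blast
qed

end
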